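(* Let $T_n$ be a tournament on $n$ vertices, and let $TR_n$ be the transitive tournament on $n$ vertices. Then $$\mathrm{allarb}(T_n)\geq \mathrm{allarb}(TR_n),$$ with equality if and only if $T_n\cong TR_n$.
   Context: A tournament on $n$ vertices is an orientation of the complete graph $K_n$. The transitive tournament $TR_n$ has vertices $1,\dots,n$ and a directed edge from $i$ to $j$ for all $i<j$. An arborescence of a directed graph $D$ rooted at a vertex $v$ is a spanning tree of $D$ in which every vertex different from $v$ has out-degree $1$ and $v$ has out-degree $0$ (every edge is oriented towards the root). $\mathrm{arb}(D,v)$ is the number of arborescences of $D$ rooted at $v$, and $\mathrm{allarb}(D)=\sum_{v\in V}\mathrm{arb}(D,v)$. *)

theory Defs
  imports "Graph_Theory.Digraph_Component" "Graph_Theory.Digraph_Isomorphism"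
begin

locale tournament = digraph +
  assumes orientation:
    "\<lbrakk>u \<in> verts G; v \<in> verts G; u \<noteq> v\<rbrakk> \<Longrightarrow> (u \<rightarrow> v) \<longleftrightarrow> \<not> (v \<rightarrow> u)"

definition transitive_tournament :: "nat \<Rightarrow> (nat, nat \<times> nat) pre_digraph" where
  "transitive_tournament n =
    \<lparr>verts = {1..n}, arcs = {(i, j). i \<in> {1..n} \<and> j \<in> {1..n} \<and> i < j}, tail = fst, head = snd\<rparr>"

text \<open>
  A cycle of the underlying undirected multigraph: distinct vertices \<open>vs\<close> and distinct arcs \<open>es\<close>,
  where \<open>es ! i\<close> joins \<open>vs ! i\<close> to its cyclic successor, in either direction. A loop is a cycle of
  length 1 and two parallel or antiparallel arcs form a cycle of length 2.
  \<^const>\<open>forest\<close> excludes only directed cycles, so \<^const>\<open>tree\<close> and \<^const>\<open>spanning_tree\<close> do not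
  express that the underlying undirected graph is a tree; a transitive tournament, for
  instance, is a \<^const>\<open>tree\<close>.
\<close>
definition undirected_cycle :: "('a, 'b) pre_digraph \<Rightarrow> 'a list \<Rightarrow> 'b list \<Rightarrow> bool" where
  "undirected_cycle H vs es \<longleftrightarrow>
    vs \<noteq> [] \<and> length es = length vs \<and> distinct vs \<and> distinct es \<and> set es \<subseteq> arcs H \<and>
    (\<forall>i < length vs.
      {tail H (es ! i), head H (es ! i)} = {vs ! i, vs ! (Suc i mod length vs)})"

text \<open>\<^const>\<open>connected\<close> is connectedness of the underlying undirected graph.\<close>
definition undirected_tree :: "('a, 'b) pre_digraph \<Rightarrow> bool" where
  "undirected_tree H \<longleftrightarrow> connected H \<and> (\<nexists>vs es. undirected_cycle H vs es)"

definition arborescence :: "('a, 'b) pre_digraph \<Rightarrow> 'a \<Rightarrow> ('a, 'b) pre_digraph \<Rightarrow> bool" where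
  "arborescence D v H \<longleftrightarrow>
    v \<in> verts D \<and> spanning H D \<and> undirected_tree H \<and>
    out_degree H v = 0 \<and> (\<forall>u \<in> verts D - {v}. out_degree H u = 1)"

definition arb :: "('a, 'b) pre_digraph \<Rightarrow> 'a \<Rightarrow> nat" where
  "arb D v = card {H. arborescence D v H}"

text \<open>
  The set counted by \<open>arb\<close> is finite for a finite digraph: a spanning subgraph shares the vertex
  set and the functions \<^const>\<open>tail\<close> and \<^const>\<open>head\<close> of \<open>D\<close>, hence is determined by its arcs.
\<close>
lemma (in fin_digraph) finite_arborescences: "finite {H. arborescence G v H}"
proof (rule inj_on_finite)
  show "inj_on arcs {H. arborescence G v H}"
  proof (rule inj_onI)
    fix H K :: "('a, 'b) pre_digraph"
    assume "H \<in> {H. arborescence G v H}" "K \<in> {H. arborescence G v H}" and eq: "arcs H = arcs K"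
    then have "spanning H G" "spanning K G"
      by (simp_all add: arborescence_def)
    then have "verts H = verts K" "tail H = tail K" "head H = head K"
      by (simp_all add: spanning_def subgraph_def compatible_def)
    with eq show "H = K"
      by (intro pre_digraph.equality) simp_all
  qed
  show "arcs ` {H. arborescence G v H} \<subseteq> Pow (arcs G)"
    by (auto simp: arborescence_def spanning_def subgraph_def)
qed simp

definition allarb :: "('a, 'b) pre_digraph \<Rightarrow> nat" where
  "allarb D = (\<Sum>v \<in> verts D. arb D v)"

lemma tournament_transitive_tournament: "tournament (transitive_tournament n)"
proof -
  have "finite {(i, j). i \<in> {1..n} \<and> j \<in> {1..n} \<and> i < j}"
    by (rule finite_subset[of _ "{1..n} \<times> {1..n}"]) auto
  then show ?thesis
    by unfold_locales (auto simp: transitive_tournament_def arcs_ends_def arc_to_ends_def)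
qed

end

theory Submission
  imports Defs "Jordan_Normal_Form.Determinant" "HOL-Number_Theory.Cong"
begin

text \<open>
  Let \<open>d\<^sub>i\<close> be the out-degrees of a tournament on \<open>n > 0\<close> vertices, \<open>A\<close> its adjacency matrix,
  \<open>L = diag(d) - A\<close> its Laplacian, \<open>J\<close> the all-ones matrix and \<open>F\<close> the number of all arborescences.
  The theorem follows from the two inequalities
  \<open>n * F \<ge> (\<Prod>i. d\<^sub>i + 1) \<ge> n!\<close>.

  For the first one, the directed matrix-tree theorem (\<open>matrix_tree\<close>) says that the arborescences
  rooted at \<open>v\<close> are counted by the principal minor of \<open>L\<close> at \<open>v\<close>. As the rows of \<open>L\<close> sum to zero,
  adding up these minors gives \<open>det (2L + J) = 2^(n-1) * n * F\<close>
  (\<open>rdet_double_laplacian_plus_ones\<close>). The point of this particular combination is that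
  \<open>A + A\<^sup>T = J - I\<close> in a tournament, so that \<open>2L + J = diag(2d + 1) + W\<close> with the skew-symmetric
  matrix \<open>W = A\<^sup>T - A\<close>, all of whose off-diagonal entries are \<open>\<plusminus>1\<close>. Expanding along the diagonal,
  \<open>det (2L + J)\<close> is the sum over all vertex sets \<open>S\<close> of \<open>\<Prod>i\<in>S. 2 d\<^sub>i + 1\<close> times the principal minor
  of \<open>W\<close> on the complement of \<open>S\<close>. Such a minor is nonnegative because \<open>W\<close> is skew-symmetric
  (\<open>rdet_skew_minor_nonneg\<close>), and it is odd when it has even size, because modulo 2 the matrix is then
  its own inverse (\<open>rdet_odd_minor\<close>). So every minor of even size is at least 1, and
  \<open>2 * det (2L + J) \<ge> (\<Prod>i. 2 d\<^sub>i + 2) + (\<Prod>i. 2 d\<^sub>i)\<close>.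

  The second inequality, together with the fact that equality forces the tournament to be
  transitive, is an induction that removes a vertex of maximal score (\<open>score_product_ge_fact\<close>).
  For a transitive tournament the minors are triangular and give \<open>F = (n - 1)!\<close>, so \<open>F = (n - 1)!\<close>
  characterises the transitive tournaments.
\<close>

section \<open>Determinants given by rows\<close>

text \<open>
  Matrices are handled through their rows, as functions of a row index and a column index. Row
  expansions then become case distinctions on the row index.
\<close>
abbreviation rdet :: "nat \<Rightarrow> (nat \<Rightarrow> nat \<Rightarrow> 'a) \<Rightarrow> 'a::comm_ring_1" where
  "rdet n r \<equiv> det (mat n n (\<lambda>(i, j). r i j))"

lemma rdet_leibniz:
  "rdet n r = (\<Sum>p | p permutes {0..<n}. signof p * (\<Prod>i = 0..<n. r i (p i)))"
proof -
  have "rdet n r = (\<Sum>p | p permutes {0..<n}.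
      signof p * (\<Prod>i = 0..<n. mat n n (\<lambda>(i, j). r i j) $$ (i, p i)))"
    by (rule det_def') simp
  also have "\<dots> = (\<Sum>p | p permutes {0..<n}. signof p * (\<Prod>i = 0..<n. r i (p i)))"
    by (intro sum.cong refl arg_cong2[where f = "(*)"] prod.cong) auto
  finally show ?thesis .
qed

lemma rdet_cong:
  assumes "\<And>i j. i < n \<Longrightarrow> j < n \<Longrightarrow> r i j = s i j"
  shows "rdet n r = rdet n s"
  using assms by (intro arg_cong[where f = det] eq_matI) auto

lemma rdet_of_int: "rdet n (\<lambda>i j. of_int (r i j)) = (of_int (rdet n r) :: 'a::comm_ring_1)"
proof -
  have "mat n n (\<lambda>(i, j). of_int (r i j) :: 'a) = map_mat of_int (mat n n (\<lambda>(i, j). r i j))"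
    by (intro eq_matI) auto
  then show ?thesis
    by (simp only: of_int_hom.hom_det)
qed

text \<open>
  Multilinearity in all rows at once: each product in the Leibniz formula is a product of sums,
  and expanding it amounts to choosing one summand in every row.
\<close>
lemma rdet_sum_rows:
  assumes "\<And>i. i < n \<Longrightarrow> finite (K i)"
  shows "rdet n (\<lambda>i j. \<Sum>k\<in>K i. c i k j) =
    (\<Sum>f\<in>PiE {0..<n} K. rdet n (\<lambda>i. c i (f i)))"
proof -
  have "(\<Prod>i = 0..<n. \<Sum>k\<in>K i. c i k (p i)) = (\<Sum>f\<in>PiE {0..<n} K. \<Prod>i = 0..<n. c i (f i) (p i))" for p
    using assms by (intro prod_sum_PiE) auto
  then show ?thesis
    unfolding rdet_leibniz by (simp add: sum_distrib_left) (rule sum.swap)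
qed

lemma rdet_add_rows:
  "rdet n (\<lambda>i j. r i j + s i j) = (\<Sum>S\<in>Pow {0..<n}. rdet n (\<lambda>i. if i \<in> S then r i else s i))"
proof -
  have "(\<Prod>i = 0..<n. r i (p i) + s i (p i)) =
      (\<Sum>S\<in>Pow {0..<n}. \<Prod>i = 0..<n. (if i \<in> S then r i else s i) (p i))" for p
  proof -
    have "(\<Prod>i\<in>S. r i (p i)) * (\<Prod>i\<in>{0..<n} - S. s i (p i)) =
        (\<Prod>i = 0..<n. (if i \<in> S then r i else s i) (p i))" if "S \<subseteq> {0..<n}" for S
    proof -
      have "(\<Prod>i = 0..<n. (if i \<in> S then r i else s i) (p i)) =
          (\<Prod>i\<in>S. (if i \<in> S then r i else s i) (p i)) * (\<Prod>i\<in>{0..<n} - S. (if i \<in> S then r i else s i) (p i))"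
        using prod.subset_diff[OF that finite_atLeastLessThan] by (subst mult.commute)
      also have "\<dots> = (\<Prod>i\<in>S. r i (p i)) * (\<Prod>i\<in>{0..<n} - S. s i (p i))"
        by (intro arg_cong2[where f = "(*)"] prod.cong) auto
      finally show ?thesis ..
    qed
    then show ?thesis
      by (subst prod_add) (auto intro!: sum.cong)
  qed
  then show ?thesis
    unfolding rdet_leibniz by (simp add: sum_distrib_left) (rule sum.swap)
qed

lemma rdet_scale_rows: "rdet n (\<lambda>i j. a i * r i j) = (\<Prod>i = 0..<n. a i) * rdet n r"
  unfolding rdet_leibniz by (simp add: prod.distrib sum_distrib_left mult.left_commute)

lemma rdet_eq_0_iff:
  fixes r :: "nat \<Rightarrow> nat \<Rightarrow> 'a::idom"
  shows "rdet n r = 0 \<longleftrightarrow> (\<exists>x. (\<exists>j<n. x j \<noteq> 0) \<and> (\<forall>i<n. (\<Sum>j = 0..<n. r i j * x j) = 0))"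
proof -
  let ?A = "mat n n (\<lambda>(i, j). r i j)"
  have A: "?A \<in> carrier_mat n n"
    by simp
  have mv: "(?A *\<^sub>v vec n x = 0\<^sub>v n) \<longleftrightarrow> (\<forall>i<n. (\<Sum>j = 0..<n. r i j * x j) = 0)" for x
    by (auto simp: vec_eq_iff scalar_prod_def)
  have nz: "vec n x \<noteq> 0\<^sub>v n \<longleftrightarrow> (\<exists>j<n. x j \<noteq> 0)" for x :: "nat \<Rightarrow> 'a"
    by (auto simp: vec_eq_iff)
  have ex: "(\<exists>v. v \<in> carrier_vec n \<and> P v) \<longleftrightarrow> (\<exists>x. P (vec n x))" for P :: "'a vec \<Rightarrow> bool"
  proof
    assume "\<exists>v. v \<in> carrier_vec n \<and> P v"
    then obtain v where "v \<in> carrier_vec n" "P v"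
      by blast
    then have "P (vec n (($) v))"
      by (metis carrier_vecD eq_vecI index_vec dim_vec)
    then show "\<exists>x. P (vec n x)"
      by (intro exI[where x = "($) v"])
  qed (auto intro: vec_carrier)
  show ?thesis
    unfolding det_0_iff_vec_prod_zero[OF A] ex mv nz ..
qed

lemma rdet_eq_0I:
  fixes r :: "nat \<Rightarrow> nat \<Rightarrow> 'a::idom"
  assumes "j < n" "x j \<noteq> 0" "\<And>i. i < n \<Longrightarrow> (\<Sum>j = 0..<n. r i j * x j) = 0"
  shows "rdet n r = 0"
  using assms rdet_eq_0_iff by metis

lemma rdet_identity: "rdet n (\<lambda>i j. if i = j then 1 else 0) = (1 :: 'a::comm_ring_1)"
proof -
  have "mat n n (\<lambda>(i, j). if i = j then 1 else 0) = (1\<^sub>m n :: 'a mat)"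
    by (intro eq_matI) auto
  then show ?thesis
    by simp
qed

lemma sum_delta_diff:
  fixes x :: "nat \<Rightarrow> 'a::comm_ring_1"
  assumes "a < n" "b < n"
  shows "(\<Sum>j = 0..<n. ((if j = a then 1 else 0) - (if j = b then 1 else 0)) * x j) = x a - x b"
proof -
  have "(\<Sum>j = 0..<n. ((if j = a then 1 else 0) - (if j = b then 1 else 0)) * x j) =
     (\<Sum>j = 0..<n. (if j = a then x j else 0) - (if j = b then x j else 0))"
    by (intro sum.cong) auto
  then show ?thesis
    using assms by (simp add: sum_subtractf)
qed

text \<open>
  The combinatorial core of the matrix-tree theorem. A permutation with a nonzero term sends every
  moved \<open>i\<close> to \<open>f i\<close>; by injectivity \<open>f i\<close> is moved as well, so if every orbit of \<open>f\<close> ends in the fixed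
  point \<open>v\<close>, only the identity contributes. Otherwise the indicator function of the points that never
  reach \<open>v\<close> lies in the kernel.
\<close>
lemma rdet_functional_digraph:
  fixes f :: "nat \<Rightarrow> nat"
  assumes v: "v < n" and f: "\<And>i. i < n \<Longrightarrow> f i < n" and fv: "f v = v"
  shows "rdet n (\<lambda>i j. if i = v then (if j = v then 1 else 0)
        else (if j = i then 1 else 0) - (if j = f i then 1 else 0)) =
    (if \<forall>i<n. \<exists>k. (f ^^ k) i = v then 1 else (0::'a::idom))"
    (is "rdet n ?r = _")
proof (cases "\<forall>i<n. \<exists>k. (f ^^ k) i = v")
  case True
  have zero: "(\<Prod>i = 0..<n. ?r i (p i)) = (0::'a)" if p: "p permutes {0..<n}" and "p \<noteq> id" for p
  proof (rule ccontr)
    assume "(\<Prod>i = 0..<n. ?r i (p i)) \<noteq> (0::'a)"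
    then have nz: "?r i (p i) \<noteq> (0::'a)" if "i < n" for i
      using that by auto
    have pv: "p v = v"
      using nz[OF v] by (simp split: if_splits)
    have step: "p i = f i" if "i < n" "p i \<noteq> i" for i
      using nz[OF that(1)] that pv by (auto split: if_splits)
    from \<open>p \<noteq> id\<close> obtain i where i: "p i \<noteq> i"
      by (auto simp: fun_eq_iff)
    have "i < n"
      using i p by (metis atLeastLessThan_iff permutes_not_in zero_le)
    have moved: "(f ^^ k) i < n \<and> p ((f ^^ k) i) \<noteq> (f ^^ k) i" for k
    proof (induction k)
      case 0
      then show ?case using i \<open>i < n\<close> by simp
    next
      case (Suc k)
      then have "p ((f ^^ k) i) = f ((f ^^ k) i)"
        using step by blast
      then show ?case
        using Suc f permutes_inj[OF p] by (metis comp_apply funpow.simps(2) inj_eq)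
    qed
    obtain k where "(f ^^ k) i = v"
      using True \<open>i < n\<close> by blast
    then show False
      using moved[of k] pv by simp
  qed
  have "rdet n ?r = (\<Sum>p\<in>{id}. signof p * (\<Prod>i = 0..<n. ?r i (p i)) :: 'a)"
    unfolding rdet_leibniz
    by (rule sum.mono_neutral_right) (use zero in \<open>auto simp: permutes_id finite_permutations\<close>)
  also have "(\<Prod>i = 0..<n. ?r i (id i)) = (1::'a)"
  proof (rule prod.neutral, safe)
    fix i assume "i \<in> {0..<n}"
    have "f i \<noteq> i" if "i \<noteq> v"
    proof
      assume "f i = i"
      then have "(f ^^ k) i = i" for k
        by (induction k) auto
      then show False
        using True \<open>i \<in> {0..<n}\<close> \<open>i \<noteq> v\<close> by auto
    qed
    then show "?r i (id i) = 1"
      by (metis diff_zero id_apply)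
  qed
  then have "(\<Sum>p\<in>{id :: nat \<Rightarrow> nat}. signof p * (\<Prod>i = 0..<n. ?r i (p i))) = (1::'a)"
    by (simp only: sum.insert finite.emptyI empty_iff not_False_eq_True sum.empty sign_id
        of_int_1 mult_1_left add_0_right)
  finally show ?thesis
    using True by simp
next
  case False
  then obtain i0 where i0: "i0 < n" "\<And>k. (f ^^ k) i0 \<noteq> v"
    by blast
  define x :: "nat \<Rightarrow> 'a" where "x j = (if \<exists>k. (f ^^ k) j = v then 0 else 1)" for j
  have xv: "x v = 0"
    unfolding x_def using funpow_0 by metis
  have xf: "x (f i) = x i" for i
  proof -
    have "(\<exists>k. (f ^^ k) (f i) = v) \<longleftrightarrow> (\<exists>k. (f ^^ k) i = v)"
    proof
      assume "\<exists>k. (f ^^ k) (f i) = v"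
      then show "\<exists>k. (f ^^ k) i = v"
        by (metis comp_apply funpow_Suc_right)
    next
      assume "\<exists>k. (f ^^ k) i = v"
      then obtain k where "(f ^^ k) i = v" ..
      then have "(f ^^ k) (f i) = v"
        using fv by (metis funpow_swap1)
      then show "\<exists>k. (f ^^ k) (f i) = v" ..
    qed
    then show ?thesis
      by (simp add: x_def)
  qed
  have "rdet n ?r = (0::'a)"
  proof (rule rdet_eq_0I[where x = x and j = i0])
    show "x i0 \<noteq> 0"
      using i0 by (simp add: x_def)
    fix i assume "i < n"
    show "(\<Sum>j = 0..<n. ?r i j * x j) = 0"
    proof (cases "i = v")
      case True
      have "(\<Sum>j = 0..<n. ?r i j * x j) = (\<Sum>j = 0..<n. 0)"
        using True xv by (intro sum.cong) auto
      then show ?thesis by simp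
    next
      case False
      then have "(\<Sum>j = 0..<n. ?r i j * x j) = x i - x (f i)"
        using sum_delta_diff[OF \<open>i < n\<close> f[OF \<open>i < n\<close>], of x] by simp
      then show ?thesis by (simp add: xf)
    qed
  qed (use i0 in auto)
  then show ?thesis
    using False by simp
qed

section \<open>The matrix-tree theorem\<close>

definition outs :: "nat \<Rightarrow> (nat \<Rightarrow> nat \<Rightarrow> bool) \<Rightarrow> nat \<Rightarrow> nat set" where
  "outs n E i = {j. j < n \<and> E i j}"

lemma finite_outs [simp]: "finite (outs n E i)"
  by (simp add: outs_def)

definition laplacian :: "nat \<Rightarrow> (nat \<Rightarrow> nat \<Rightarrow> bool) \<Rightarrow> nat \<Rightarrow> nat \<Rightarrow> real" where
  "laplacian n E i j = (if j = i then real (card (outs n E i)) else 0) - (if E i j then 1 else 0)"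

lemma laplacian_eq_sum:
  assumes "j < n"
  shows "laplacian n E i j =
    (\<Sum>w\<in>outs n E i. (if j = i then 1 else 0) - (if j = w then 1 else 0))"
proof -
  have "(\<Sum>w\<in>outs n E i. if j = w then 1 else (0::real)) = (if E i j then 1 else 0)"
    using assms by (simp add: outs_def)
  then show ?thesis
    by (simp add: laplacian_def sum_subtractf)
qed

lemma laplacian_row_sum:
  assumes "i < n"
  shows "(\<Sum>j = 0..<n. laplacian n E i j) = 0"
proof -
  have "(\<Sum>j = 0..<n. if E i j then 1 else 0) = real (card (outs n E i))"
    by (simp add: sum.If_cases outs_def Int_def conj_commute)
  then show ?thesis
    using assms by (simp add: laplacian_def sum_subtractf)
qed

text \<open>
  These functions encode the arborescences rooted at \<open>r\<close> of the digraph with out-neighbourhoods \<open>N\<close>: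
  each vertex is sent to the head of its arc, and the root, which has no arc, to itself.
\<close>
definition parent_functions :: "'a set \<Rightarrow> ('a \<Rightarrow> 'a set) \<Rightarrow> 'a \<Rightarrow> ('a \<Rightarrow> 'a) set" where
  "parent_functions V N r = {f \<in> PiE V (\<lambda>u. if u = r then {r} else N u).
     \<forall>u\<in>V. \<exists>k. (f ^^ k) u = r}"

text \<open>
  Replacing row \<open>v\<close> of the Laplacian by the unit vector has the same determinant as deleting row and
  column \<open>v\<close>, and avoids renumbering the remaining rows.
\<close>
definition rooted_minor :: "nat \<Rightarrow> (nat \<Rightarrow> nat \<Rightarrow> bool) \<Rightarrow> nat \<Rightarrow> real" where
  "rooted_minor n E v = rdet n (\<lambda>i j. if i = v then (if j = v then 1 else 0) else laplacian n E i j)"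

text \<open>
  Row \<open>i\<close> of the Laplacian is the sum over the out-neighbours \<open>w\<close> of \<open>i\<close> of the rows \<open>e\<^sub>i - e\<^sub>w\<close>.
  Expanding all rows but the one of the root yields one determinant for each choice of parents.
\<close>
theorem matrix_tree:
  assumes v: "v < n"
  shows "rooted_minor n E v = real (card (parent_functions {0..<n} (outs n E) v))"
proof -
  let ?K = "\<lambda>i. if i = v then {v} else outs n E i"
  let ?c = "\<lambda>i w j. if i = v then (if j = v then 1 else 0)
    else (if j = i then 1 else 0) - (if j = w then 1 else (0::real))"
  have "rooted_minor n E v = rdet n (\<lambda>i j. \<Sum>w\<in>?K i. ?c i w j)"
    unfolding rooted_minor_def by (rule rdet_cong) (auto simp: laplacian_eq_sum)
  also have "\<dots> = (\<Sum>f\<in>PiE {0..<n} ?K. rdet n (\<lambda>i. ?c i (f i)))"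
    by (rule rdet_sum_rows) simp
  also have "\<dots> = (\<Sum>f\<in>PiE {0..<n} ?K. if \<forall>i<n. \<exists>k. (f ^^ k) i = v then 1 else 0)"
  proof (rule sum.cong)
    fix f assume f: "f \<in> PiE {0..<n} ?K"
    have mem: "f i \<in> ?K i" if "i < n" for i
      using f that by (auto dest: PiE_mem)
    show "rdet n (\<lambda>i. ?c i (f i)) = (if \<forall>i<n. \<exists>k. (f ^^ k) i = v then 1 else 0)"
    proof (rule rdet_functional_digraph[OF v])
      show "f v = v"
        using mem[OF v] by simp
      show "f i < n" if "i < n" for i
        using mem[OF that] v by (auto simp: outs_def split: if_splits)
    qed
  qed simp
  also have "\<dots> = real (card (parent_functions {0..<n} (outs n E) v))"
    by (subst sum.If_cases) (auto simp: parent_functions_def Int_def Ball_def finite_PiE)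
  finally show ?thesis .
qed

lemma rdet_two_ones_rows:
  assumes "i < n" "k < n" "i \<noteq> k" "i \<in> S" "k \<in> S"
  shows "rdet n (\<lambda>i. if i \<in> S then (\<lambda>j. 1) else r i) = 0"
  by (rule det_identical_rows[of _ n i k]) (use assms in \<open>auto intro!: eq_vecI\<close>)

text \<open>
  Subtracting \<open>n e\<^sub>v\<close> from the row of ones makes all row sums vanish, so the determinant of the
  difference is zero.
\<close>
lemma rdet_laplacian_ones_row:
  assumes v: "v < n"
  shows "rdet n (\<lambda>i j. if i = v then 1 else laplacian n E i j) = real n * rooted_minor n E v"
proof -
  let ?L = "laplacian n E"
  let ?a = "\<lambda>i j. if i = v then 1 - real n * (if j = v then 1 else 0) else ?L i j"
  let ?b = "\<lambda>i j. if i = v then real n * (if j = v then 1 else 0) else 0"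
  have zero: "rdet n (\<lambda>i. if i \<in> S then ?a i else ?b i) = 0" if "S \<in> Pow {0..<n} - {{0..<n} - {v}}" for S
  proof (cases "S = {0..<n}")
    case True
    show ?thesis
    proof (rule rdet_eq_0I[where x = "\<lambda>_. 1" and j = v])
      fix i assume "i < n"
      have "(\<Sum>j = 0..<n. 1 - real n * (if j = v then 1 else 0)) =
          (\<Sum>j = 0..<n. 1) - real n * (\<Sum>j = 0..<n. if j = v then 1 else 0)"
        by (simp only: sum_subtractf sum_distrib_left)
      also have "\<dots> = 0"
        using v by simp
      finally show "(\<Sum>j = 0..<n. (if i \<in> S then ?a i else ?b i) j * 1) = 0"
        using True \<open>i < n\<close> laplacian_row_sum[of i n E] by (cases "i = v") simp_all
    qed (use v in auto)
  next
    case False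
    have "\<not> {0..<n} - {v} \<subseteq> S"
    proof
      assume "{0..<n} - {v} \<subseteq> S"
      then have "S = {0..<n} \<or> S = {0..<n} - {v}"
        using that by (cases "v \<in> S") auto
      then show False
        using False that by simp
    qed
    then obtain i where "i \<in> {0..<n} - {v}" "i \<notin> S"
      by blast
    then have "i < n" "i \<noteq> v"
      by auto
    then show ?thesis
      unfolding rdet_leibniz using \<open>i \<notin> S\<close>
      by (intro sum.neutral ballI) (auto intro!: prod_zero bexI[of _ i])
  qed
  have "rdet n (\<lambda>i j. if i = v then 1 else ?L i j) = rdet n (\<lambda>i j. ?a i j + ?b i j)"
    by (rule rdet_cong) auto
  also have "\<dots> = (\<Sum>S\<in>Pow {0..<n}. rdet n (\<lambda>i. if i \<in> S then ?a i else ?b i))"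
    by (rule rdet_add_rows)
  also have "\<dots> = (\<Sum>S\<in>{{0..<n} - {v}}. rdet n (\<lambda>i. if i \<in> S then ?a i else ?b i))"
    by (rule sum.mono_neutral_right) (use zero in auto)
  also have "\<dots> = rdet n (\<lambda>i j. (if i = v then real n else 1) *
      (if i = v then (if j = v then 1 else 0) else ?L i j))"
    by (simp, rule rdet_cong) auto
  also have "\<dots> = real n * rooted_minor n E v"
    unfolding rdet_scale_rows rooted_minor_def using v by (simp add: prod.delta)
  finally show ?thesis .
qed

text \<open>
  In the expansion of the sum of \<open>J\<close> and \<open>2L\<close> by rows, a term with two rows of ones vanishes, and so
  does the term without any, because the row sums of the Laplacian are zero. Exactly one row of ones
  remains.
\<close>
lemma rdet_double_laplacian_plus_ones:
  assumes "n > 0"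
  shows "rdet n (\<lambda>i j. 2 * laplacian n E i j + 1) =
    2 ^ (n - 1) * real n * (\<Sum>v<n. rooted_minor n E v)"
proof -
  let ?L = "laplacian n E"
  let ?r = "\<lambda>S i. if i \<in> S then (\<lambda>j. 1) else (\<lambda>j. 2 * ?L i j)"
  have "rdet n (\<lambda>i j. 2 * ?L i j + 1) = rdet n (\<lambda>i j. 1 + 2 * ?L i j)"
    by (simp add: add.commute)
  also have "\<dots> = (\<Sum>S\<in>Pow {0..<n}. rdet n (?r S))"
    by (rule rdet_add_rows)
  also have "\<dots> = (\<Sum>S\<in>(\<lambda>v. {v}) ` {..<n}. rdet n (?r S))"
  proof (rule sum.mono_neutral_right)
    show "\<forall>S\<in>Pow {0..<n} - (\<lambda>v. {v}) ` {..<n}. rdet n (?r S) = 0"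
    proof
      fix S assume S: "S \<in> Pow {0..<n} - (\<lambda>v. {v}) ` {..<n}"
      show "rdet n (?r S) = 0"
      proof (cases "S = {}")
        case True
        show ?thesis
        proof (rule rdet_eq_0I[where x = "\<lambda>_. 1" and j = 0])
          fix i assume "i < n"
          then show "(\<Sum>j = 0..<n. ?r S i j * 1) = 0"
            using True by (simp add: laplacian_row_sum flip: sum_distrib_left)
        qed (use assms in auto)
      next
        case nonempty: False
        then obtain i where i: "i \<in> S" by blast
        moreover have "S \<noteq> {i}" "i < n"
          using S i by auto
        ultimately obtain k where k: "k \<in> S" "k \<noteq> i" by blast
        show ?thesis
          by (rule rdet_two_ones_rows[of i n k]) (use S i k in auto)
      qed
    qed
  qed auto
  also have "\<dots> = (\<Sum>v<n. rdet n (?r {v}))"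
    by (subst sum.reindex) auto
  also have "\<dots> = (\<Sum>v<n. 2 ^ (n - 1) * (real n * rooted_minor n E v))"
  proof (rule sum.cong)
    fix v assume "v \<in> {..<n}"
    then have v: "v < n" by simp
    have "rdet n (?r {v}) = rdet n (\<lambda>i j. (if i = v then 1 else 2) * (if i = v then 1 else ?L i j))"
      by (rule rdet_cong) auto
    also have "\<dots> = (\<Prod>i = 0..<n. if i = v then 1 else 2) * (real n * rooted_minor n E v)"
      by (simp only: rdet_scale_rows rdet_laplacian_ones_row[OF v])
    also have "(\<Prod>i = 0..<n. if i = v then 1 else 2) = (2::real) ^ (n - 1)"
      using v by (subst prod.remove[of _ v]) (auto simp: prod.If_cases)
    finally show "rdet n (?r {v}) = 2 ^ (n - 1) * (real n * rooted_minor n E v)" .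
  qed simp
  also have "\<dots> = 2 ^ (n - 1) * real n * (\<Sum>v<n. rooted_minor n E v)"
    by (simp add: sum_distrib_left mult.assoc)
  finally show ?thesis .
qed

section \<open>Skew-symmetric matrices and the minors of a tournament\<close>

lemma skew_form_eq_0:
  fixes w :: "nat \<Rightarrow> nat \<Rightarrow> real"
  assumes "\<And>i j. i < n \<Longrightarrow> j < n \<Longrightarrow> w j i = - w i j"
  shows "(\<Sum>i = 0..<n. \<Sum>j = 0..<n. x i * w i j * x j) = 0"
proof -
  let ?q = "\<Sum>i = 0..<n. \<Sum>j = 0..<n. x i * w i j * x j"
  have "?q = (\<Sum>i = 0..<n. \<Sum>j = 0..<n. x j * w j i * x i)"
    by (rule sum.swap)
  also have "\<dots> = (\<Sum>i = 0..<n. \<Sum>j = 0..<n. - (x i * w i j * x j))"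
  proof (intro sum.cong refl)
    fix i j assume "i \<in> {0..<n}" "j \<in> {0..<n}"
    then show "x j * w j i * x i = - (x i * w i j * x j)"
      using assms[of i j] by simp
  qed
  also have "\<dots> = - ?q"
    by (simp add: sum_negf)
  finally show ?thesis
    by simp
qed

text \<open>
  Taking unit vectors as the rows in \<open>S\<close> leaves the principal minor of \<open>w\<close> on the complement of \<open>S\<close>.
  Move linearly from the matrix at hand to the identity. A kernel vector \<open>x\<close> of an intermediate matrix
  vanishes on \<open>S\<close>, and the skew part contributes nothing to its quadratic form, so
  \<open>t * (\<Sum>i. (x i)\<^sup>2) = 0\<close>. Hence the determinant has no zero for \<open>0 < t \<le> 1\<close>; being 1 at the end, it
  cannot be negative at the beginning.
\<close>
lemma rdet_skew_minor_nonneg: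
  fixes w :: "nat \<Rightarrow> nat \<Rightarrow> real"
  assumes skew: "\<And>i j. i < n \<Longrightarrow> j < n \<Longrightarrow> w j i = - w i j"
  shows "rdet n (\<lambda>i. if i \<in> S then (\<lambda>j. if i = j then 1 else 0) else w i) \<ge> 0"
proof (rule ccontr)
  \<comment> \<open>The point of the segment at parameter \<open>t\<close>; the identity is at 1.\<close>
  define r where "r t i j = (if i \<in> S then (if i = j then 1 else 0)
    else (1 - t) * w i j + t * (if i = j then 1 else 0))" for t i j
  define h where "h t = rdet n (r t)" for t
  assume "\<not> ?thesis"
  moreover have "h 0 = rdet n (\<lambda>i. if i \<in> S then (\<lambda>j. if i = j then 1 else 0) else w i)"
    unfolding h_def r_def by (rule rdet_cong) auto
  ultimately have h0: "h 0 < 0"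
    by simp
  have "h 1 = rdet n (\<lambda>i j. if i = j then 1 else 0)"
    unfolding h_def r_def by (rule rdet_cong) auto
  then have h1: "h 1 = 1"
    by (simp only: rdet_identity)
  have cont: "continuous_on {0..1} h"
  proof -
    have "continuous_on {0..1} (\<lambda>t. r t i j)" for i j
      unfolding r_def by (cases "i \<in> S") (auto intro!: continuous_intros)
    then show ?thesis
      unfolding h_def rdet_leibniz by (intro continuous_intros)
  qed
  obtain t where t: "0 \<le> t" "t \<le> 1" "h t = 0"
    using IVT'[of h 0 0 1] h0 h1 cont by auto
  then have "t > 0"
    using h0 by (cases "t = 0") auto
  obtain x where x: "\<exists>j<n. x j \<noteq> 0" "\<And>i. i < n \<Longrightarrow> (\<Sum>j = 0..<n. r t i j * x j) = 0"
    using t(3) unfolding h_def rdet_eq_0_iff by auto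
  have delta: "(\<Sum>j = 0..<n. (if i = j then 1 else 0) * x j) = x i" if "i < n" for i
  proof -
    have "(\<Sum>j = 0..<n. (if i = j then 1 else 0) * x j) = (\<Sum>j = 0..<n. if i = j then x j else 0)"
      by (intro sum.cong) auto
    then show ?thesis using that by simp
  qed
  have row: "(1 - t) * (\<Sum>j = 0..<n. x i * w i j * x j) + t * (x i)\<^sup>2 = 0" if "i < n" for i
  proof (cases "i \<in> S")
    case True
    then have "x i = 0"
      using x(2)[OF that] delta[OF that] by (simp add: r_def)
    then show ?thesis by simp
  next
    case False
    have "x i * (\<Sum>j = 0..<n. r t i j * x j) =
        x i * ((1 - t) * (\<Sum>j = 0..<n. w i j * x j) + t * (\<Sum>j = 0..<n. (if i = j then 1 else 0) * x j))"
      using False by (simp only: r_def if_False distrib_right sum.distrib sum_distrib_left mult.assoc)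
    also have "\<dots> = (1 - t) * (x i * (\<Sum>j = 0..<n. w i j * x j)) + t * (x i)\<^sup>2"
      unfolding delta[OF that] by (simp add: algebra_simps power2_eq_square)
    also have "x i * (\<Sum>j = 0..<n. w i j * x j) = (\<Sum>j = 0..<n. x i * w i j * x j)"
      by (simp add: sum_distrib_left mult.assoc)
    finally show ?thesis
      using x(2)[OF that] by simp
  qed
  have "(\<Sum>i = 0..<n. (1 - t) * (\<Sum>j = 0..<n. x i * w i j * x j) + t * (x i)\<^sup>2) = 0"
    by (rule sum.neutral) (use row in auto)
  then have "(1 - t) * (\<Sum>i = 0..<n. \<Sum>j = 0..<n. x i * w i j * x j) + t * (\<Sum>i = 0..<n. (x i)\<^sup>2) = 0"
    by (simp only: sum.distrib sum_distrib_left)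
  then have "(\<Sum>i = 0..<n. (x i)\<^sup>2) = 0"
    using skew_form_eq_0[of n w x, OF skew] \<open>t > 0\<close> by simp
  then show False
    using x(1) by (auto simp: sum_nonneg_eq_0_iff)
qed

lemma rdet_cong_mod:
  fixes r s :: "nat \<Rightarrow> nat \<Rightarrow> int"
  assumes "\<And>i j. i < n \<Longrightarrow> j < n \<Longrightarrow> [r i j = s i j] (mod m)"
  shows "[rdet n r = rdet n s] (mod m)"
  unfolding rdet_leibniz
proof (intro cong_sum cong_mult cong_prod)
  fix p i assume "p \<in> {p. p permutes {0..<n}}" "i \<in> {0..<n}"
  then show "[r i (p i) = s i (p i)] (mod m)"
    using permutes_in_image[of p "{0..<n}" i] by (intro assms) auto
qed simp

lemma rdet_mult: "rdet n r * rdet n s = rdet n (\<lambda>i k. \<Sum>j = 0..<n. r i j * s j k)"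
proof -
  have "rdet n r * rdet n s = det (mat n n (\<lambda>(i, j). r i j) * mat n n (\<lambda>(i, j). s i j))"
    by (rule det_mult[symmetric]) auto
  also have "mat n n (\<lambda>(i, j). r i j) * mat n n (\<lambda>(i, j). s i j) =
      mat n n (\<lambda>(i, k). \<Sum>j = 0..<n. r i j * s j k)"
    by (intro eq_matI) (auto simp: scalar_prod_def)
  finally show ?thesis .
qed

text \<open>
  Modulo 2 the matrix squares to the identity: for \<open>i \<notin> S\<close>, the number of odd summands in the entry
  at \<open>(i, k)\<close> of the square is \<open>m\<close>, \<open>m - 1\<close> or \<open>m - 2\<close>, according to whether \<open>k \<in> S\<close>, \<open>k = i\<close> or
  neither, where \<open>m\<close> is the even size of the complement of \<open>S\<close>.
\<close>
lemma rdet_odd_minor: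
  fixes w :: "nat \<Rightarrow> nat \<Rightarrow> int"
  assumes odd: "\<And>i j. i < n \<Longrightarrow> j < n \<Longrightarrow> odd (w i j) \<longleftrightarrow> i \<noteq> j"
    and S: "S \<subseteq> {0..<n}" and ev: "even (card ({0..<n} - S))"
  shows "odd (rdet n (\<lambda>i. if i \<in> S then (\<lambda>j. if i = j then 1 else 0) else w i))"
proof -
  define r where "r = (\<lambda>i. if i \<in> S then (\<lambda>j. if i = j then 1 else 0) else w i)"
  define T where "T = {0..<n} - S"
  have T: "finite T" "even (card T)" "T \<inter> S = {}" "\<And>j. j < n \<Longrightarrow> j \<in> T \<longleftrightarrow> j \<notin> S"
    using ev by (auto simp: T_def)
  have even_w: "even (w i j) \<longleftrightarrow> i = j" if "i < n" "j < n" for i j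
    using odd[OF that] by blast
  have entry: "odd (\<Sum>j = 0..<n. r i j * r j k) \<longleftrightarrow> i = k" if "i < n" "k < n" for i k
  proof (cases "i \<in> S")
    case True
    then have "(\<Sum>j = 0..<n. r i j * r j k) = (\<Sum>j = 0..<n. if i = j then r j k else 0)"
      by (intro sum.cong) (auto simp: r_def)
    then show ?thesis
      using that True by (simp add: r_def)
  next
    case False
    have "{j \<in> {0..<n}. odd (r i j * r j k)} =
        (if k \<in> S then insert k (T - {i}) else if i = k then T - {i} else T - {i} - {k})"
      using False S that unfolding T_def by (auto simp: r_def even_w split: if_splits)
    moreover have "card (insert k (T - {i})) = card T" if "k \<in> S"
    proof -
      have "k \<notin> T - {i}" "i \<in> T"
        using that T False \<open>i < n\<close> by auto
      then show ?thesis
        using T(1) card_Suc_Diff1[of T i] by simp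
    qed
    moreover have "odd (card (T - {i}))"
      using T False \<open>i < n\<close> card_Suc_Diff1[of T i] by (metis even_Suc)
    moreover have "even (card (T - {i} - {k}))" if "k \<notin> S" "i \<noteq> k"
    proof -
      have "k \<in> T - {i}"
        using that T \<open>k < n\<close> by auto
      then show ?thesis
        using \<open>odd (card (T - {i}))\<close> T(1) card_Suc_Diff1[of "T - {i}" k] by (metis even_Suc finite_Diff)
    qed
    ultimately show ?thesis
      using T(2) False by (auto simp: even_sum_iff)
  qed
  have "[rdet n (\<lambda>i k. \<Sum>j = 0..<n. r i j * r j k) = rdet n (\<lambda>i k. if i = k then 1 else 0)] (mod 2)"
  proof (rule rdet_cong_mod)
    fix i k assume "i < n" "k < n"
    then show "[(\<Sum>j = 0..<n. r i j * r j k) = (if i = k then 1 else 0)] (mod 2)"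
    proof (cases "i = k")
      case True
      then have "odd (\<Sum>j = 0..<n. r i j * r j k)"
        using entry \<open>i < n\<close> \<open>k < n\<close> by blast
      then show ?thesis
        using True by (simp add: cong_def odd_iff_mod_2_eq_one)
    next
      case False
      then have "even (\<Sum>j = 0..<n. r i j * r j k)"
        using entry \<open>i < n\<close> \<open>k < n\<close> by blast
      then show ?thesis
        using False by (simp add: cong_0_iff)
    qed
  qed
  then have "odd (rdet n r * rdet n r)"
    unfolding rdet_mult rdet_identity by (simp add: cong_def odd_iff_mod_2_eq_one)
  then show ?thesis
    by (simp add: r_def)
qed

text \<open>
  Each of the two products expands into a sum over the subsets \<open>S\<close>, whose terms differ by the sign \<open>(-1)^|A - S|\<close>.
\<close>
lemma even_subsets_prod_sum:
  fixes a :: "nat \<Rightarrow> real"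
  assumes "finite A"
  shows "2 * (\<Sum>S\<in>Pow A. (\<Prod>i\<in>S. a i) * (if even (card (A - S)) then 1 else 0)) =
    (\<Prod>i\<in>A. a i + 1) + (\<Prod>i\<in>A. a i - 1)"
proof -
  have "(\<Prod>i\<in>A. a i + 1) + (\<Prod>i\<in>A. a i + - 1) =
      (\<Sum>S\<in>Pow A. (\<Prod>i\<in>S. a i) * (\<Prod>i\<in>A - S. 1)) + (\<Sum>S\<in>Pow A. (\<Prod>i\<in>S. a i) * (\<Prod>i\<in>A - S. - 1))"
    using assms by (simp only: prod_add)
  also have "\<dots> = (\<Sum>S\<in>Pow A. 2 * ((\<Prod>i\<in>S. a i) * (if even (card (A - S)) then 1 else 0)))"
    unfolding sum.distrib[symmetric] by (intro sum.cong) (auto simp: minus_one_power_iff)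
  finally show ?thesis
    by (simp add: sum_distrib_left)
qed

text \<open>
  The rows of the sum are expanded into diagonal and skew parts; \<open>S\<close> collects the rows of the diagonal
  part. The minors of even size are bounded below by 1 and the others by 0.
\<close>
lemma rdet_diagonal_plus_skew_ge:
  fixes a :: "nat \<Rightarrow> real" and w :: "nat \<Rightarrow> nat \<Rightarrow> int"
  assumes a: "\<And>i. i < n \<Longrightarrow> a i \<ge> 0"
    and skew: "\<And>i j. i < n \<Longrightarrow> j < n \<Longrightarrow> w j i = - w i j"
    and odd: "\<And>i j. i < n \<Longrightarrow> j < n \<Longrightarrow> odd (w i j) \<longleftrightarrow> i \<noteq> j"
  shows "2 * rdet n (\<lambda>i j. a i * (if i = j then 1 else 0) + of_int (w i j)) \<ge>
    (\<Prod>i = 0..<n. a i + 1) + (\<Prod>i = 0..<n. a i - 1)"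
proof -
  define m where "m S = rdet n (\<lambda>i. if i \<in> S then (\<lambda>j. if i = j then 1 else 0) else w i)" for S
  have m_ge: "real_of_int (m S) \<ge> (if even (card ({0..<n} - S)) then 1 else 0)" if "S \<subseteq> {0..<n}" for S
  proof -
    have "real_of_int (m S) =
        rdet n (\<lambda>i. if i \<in> S then (\<lambda>j. if i = j then 1 else 0) else (\<lambda>j. of_int (w i j)))"
      unfolding m_def rdet_of_int[symmetric] by (rule rdet_cong) auto
    also have "\<dots> \<ge> 0"
      by (rule rdet_skew_minor_nonneg) (simp add: skew[symmetric] flip: of_int_minus)
    finally have "m S \<ge> 0"
      by simp
    moreover have "odd (m S)" if "even (card ({0..<n} - S))"
      unfolding m_def by (rule rdet_odd_minor) (use odd that \<open>S \<subseteq> _\<close> in auto)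
    ultimately show ?thesis
      by (cases "m S = 0") auto
  qed
  have term_eq: "rdet n (\<lambda>i. if i \<in> S then (\<lambda>j. a i * (if i = j then 1 else 0)) else (\<lambda>j. of_int (w i j))) =
      (\<Prod>i\<in>S. a i) * of_int (m S)" if "S \<subseteq> {0..<n}" for S
  proof -
    have "rdet n (\<lambda>i. if i \<in> S then (\<lambda>j. a i * (if i = j then 1 else 0)) else (\<lambda>j. of_int (w i j))) =
        rdet n (\<lambda>i j. (if i \<in> S then a i else 1) *
          of_int ((if i \<in> S then (\<lambda>j. if i = j then 1 else 0) else w i) j))"
      by (rule rdet_cong) auto
    also have "\<dots> = (\<Prod>i = 0..<n. if i \<in> S then a i else 1) * of_int (m S)"
      unfolding rdet_scale_rows rdet_of_int m_def ..
    also have "(\<Prod>i = 0..<n. if i \<in> S then a i else 1) = (\<Prod>i\<in>S. a i)"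
      using that by (simp add: prod.If_cases Int_absorb1 flip: prod.inter_restrict)
    finally show ?thesis .
  qed
  have "(\<Prod>i = 0..<n. a i + 1) + (\<Prod>i = 0..<n. a i - 1) =
      2 * (\<Sum>S\<in>Pow {0..<n}. (\<Prod>i\<in>S. a i) * (if even (card ({0..<n} - S)) then 1 else 0))"
    by (rule even_subsets_prod_sum[symmetric]) simp
  also have "\<dots> \<le> 2 * (\<Sum>S\<in>Pow {0..<n}. (\<Prod>i\<in>S. a i) * of_int (m S))"
    by (intro mult_left_mono sum_mono m_ge prod_nonneg ballI a) auto
  also have "(\<Sum>S\<in>Pow {0..<n}. (\<Prod>i\<in>S. a i) * of_int (m S)) =
      (\<Sum>S\<in>Pow {0..<n}. rdet n (\<lambda>i. if i \<in> S then (\<lambda>j. a i * (if i = j then 1 else 0))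
        else (\<lambda>j. of_int (w i j))))"
    by (intro sum.cong) (simp_all only: term_eq Pow_iff)
  also have "\<dots> = rdet n (\<lambda>i j. a i * (if i = j then 1 else 0) + of_int (w i j))"
    by (rule rdet_add_rows[symmetric])
  finally show ?thesis .
qed

text \<open>
  The bound \<open>n * F \<ge> (\<Prod>i. d\<^sub>i + 1)\<close>, by the decomposition of \<open>2L + J\<close> into the diagonal
  \<open>2d + 1\<close> and the skew-symmetric matrix \<open>w\<close>.
\<close>
theorem tournament_minor_sum_ge:
  assumes n: "n > 0" and irrefl: "\<And>i. \<not> E i i" and orient: "\<And>i j. i < n \<Longrightarrow> j < n \<Longrightarrow> i \<noteq> j \<Longrightarrow> E i j \<longleftrightarrow> \<not> E j i"
  shows "real n * (\<Sum>v<n. rooted_minor n E v) \<ge> (\<Prod>i = 0..<n. real (card (outs n E i)) + 1)"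
proof -
  define d where "d i = real (card (outs n E i))" for i
  define w :: "nat \<Rightarrow> nat \<Rightarrow> int" where "w i j = (if i = j then 0 else if E i j then - 1 else 1)" for i j
  have "2 ^ n * (\<Prod>i = 0..<n. d i + 1) = (\<Prod>i = 0..<n. (2 * d i + 1) + 1)"
    using prod.distrib[of "\<lambda>_. 2" "\<lambda>i. d i + 1" "{0..<n}"] by (simp add: algebra_simps)
  also have "\<dots> \<le> (\<Prod>i = 0..<n. (2 * d i + 1) + 1) + (\<Prod>i = 0..<n. (2 * d i + 1) - 1)"
    by (simp add: d_def prod_nonneg)
  also have "\<dots> \<le> 2 * rdet n (\<lambda>i j. (2 * d i + 1) * (if i = j then 1 else 0) + of_int (w i j))"
  proof (rule rdet_diagonal_plus_skew_ge)
    show "w j i = - w i j" if "i < n" "j < n" for i j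
      using orient[OF that] by (simp add: w_def)
  qed (auto simp: d_def w_def)
  also have "rdet n (\<lambda>i j. (2 * d i + 1) * (if i = j then 1 else 0) + of_int (w i j)) =
      rdet n (\<lambda>i j. 2 * laplacian n E i j + 1)"
    using irrefl by (intro rdet_cong) (auto simp: w_def d_def laplacian_def)
  also have "2 * \<dots> = 2 ^ n * (real n * (\<Sum>v<n. rooted_minor n E v))"
    unfolding rdet_double_laplacian_plus_ones[OF n] using n by (cases n) auto
  finally show ?thesis
    by (simp add: d_def)
qed

section \<open>The product of the scores\<close>

text \<open>
  Remove a vertex \<open>v\<close> of maximal score \<open>s\<close>. The score of each of its \<open>k = |V| - 1 - s\<close> in-neighbours
  drops by one, from a value that is at most \<open>s\<close>, so its factor in the product shrinks at least by the
  ratio \<open>1 + 1/s\<close>. By Bernoulli's inequality the whole product shrinks, if \<open>k > 0\<close>, at least by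
  \<open>(s + 1) * (1 + k/s)\<close>, which exceeds \<open>|V|\<close> by \<open>k/s\<close>. In the case of equality
  \<open>v\<close> therefore dominates all other vertices, and it is put in front of the enumeration obtained for them.
\<close>
lemma score_product_ge_fact:
  assumes "finite V" "card V = n"
    and "\<And>u. \<not> E u u" and "\<And>u w. u \<in> V \<Longrightarrow> w \<in> V \<Longrightarrow> u \<noteq> w \<Longrightarrow> E u w \<longleftrightarrow> \<not> E w u"
  shows "(\<Prod>u\<in>V. real (card {w\<in>V. E u w}) + 1) \<ge> fact n \<and>
    ((\<Prod>u\<in>V. real (card {w\<in>V. E u w}) + 1) = fact n \<longrightarrow>
      (\<exists>g. bij_betw g {0..<n} V \<and> (\<forall>i<n. \<forall>j<n. E (g i) (g j) \<longleftrightarrow> i < j)))"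
  using assms
proof (induction n arbitrary: V)
  case 0
  then show ?case
    by (auto simp: bij_betw_def)
next
  case (Suc m)
  note irrefl = Suc.prems(3) and orient = Suc.prems(4)
  define d where "d U u = real (card {w\<in>U. E u w})" for U u
  have "V \<noteq> {}"
    using Suc.prems(2) by auto
  then have "Max (d V ` V) \<in> d V ` V"
    using Suc.prems(1) by simp
  then obtain v where v: "v \<in> V" and "Max (d V ` V) = d V v"
    by blast
  then have vmax: "d V u \<le> d V v" if "u \<in> V" for u
    using that Suc.prems(1) by (metis Max_ge finite_imageI imageI)
  define U where "U = V - {v}"
  define s where "s = d V v"
  define I where "I = {u\<in>U. E u v}"
  have U: "finite U" "card U = m" "v \<notin> U" "V = insert v U"
    using Suc.prems(1,2) v by (auto simp: U_def)
  have IH: "(\<Prod>u\<in>U. d U u + 1) \<ge> fact m \<and> ((\<Prod>u\<in>U. d U u + 1) = fact m \<longrightarrow>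
      (\<exists>g. bij_betw g {0..<m} U \<and> (\<forall>i<m. \<forall>j<m. E (g i) (g j) \<longleftrightarrow> i < j)))"
    unfolding d_def by (rule Suc.IH[OF U(1,2) irrefl], rule orient) (auto simp: U_def)
  have s_eq: "s = real (card (U - I))"
  proof -
    have "w \<in> V \<and> E v w \<longleftrightarrow> w \<in> U - I" for w
      using orient[OF v, of w] irrefl[of v] v by (cases "w = v") (auto simp: U_def I_def)
    then have "{w\<in>V. E v w} = U - I"
      by blast
    then show ?thesis
      by (simp add: s_def d_def)
  qed
  have sI: "s + real (card I) = real m"
    using s_eq U card_Diff_subset[of I U] card_mono[of U I] by (auto simp: I_def)
  have dV: "d V u = (if u \<in> I then d U u + 1 else d U u)" if "u \<in> U" for u
  proof -
    have "{w\<in>V. E u w} = (if u \<in> I then insert v {w\<in>U. E u w} else {w\<in>U. E u w})"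
      using that U by (auto simp: I_def)
    then show ?thesis
      using U by (auto simp: d_def)
  qed
  have prodV: "(\<Prod>u\<in>V. d V u + 1) = (s + 1) * (\<Prod>u\<in>U. d V u + 1)"
    using U by (simp add: s_def)
  have d_nonneg: "d U u \<ge> 0" for u
    by (simp add: d_def)
  show ?case
  proof (cases "I = {}")
    case True
    have "(\<Prod>u\<in>V. d V u + 1) = real (Suc m) * (\<Prod>u\<in>U. d U u + 1)"
      unfolding prodV using sI dV True by simp
    moreover have "\<exists>g. bij_betw g {0..<Suc m} V \<and> (\<forall>i<Suc m. \<forall>j<Suc m. E (g i) (g j) \<longleftrightarrow> i < j)"
      if g: "bij_betw g {0..<m} U" "\<forall>i<m. \<forall>j<m. E (g i) (g j) \<longleftrightarrow> i < j" for g
    proof (intro exI conjI allI impI)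
      let ?g = "\<lambda>i. case i of 0 \<Rightarrow> v | Suc k \<Rightarrow> g k"
      have gU: "g k \<in> U" if "k < m" for k
        using g(1) that by (auto simp: bij_betw_def)
      have "?g ` {0..<Suc m} = insert v (g ` {0..<m})"
        by (simp only: image_image image_insert atLeast0_lessThan_Suc_eq_insert_0) simp
      moreover have "inj_on ?g {0..<Suc m}"
        using g(1) gU U(3) by (auto simp: inj_on_def bij_betw_def split: nat.splits)
      ultimately show "bij_betw ?g {0..<Suc m} V"
        using g(1) U(4) by (simp add: bij_betw_def)
      fix i j assume "i < Suc m" "j < Suc m"
      have "E v (g k)" "\<not> E (g k) v" if "k < m" for k
      proof -
        show "\<not> E (g k) v"
          using gU[OF that] True by (auto simp: I_def)
        then show "E v (g k)"
          using gU[OF that] orient[OF v, of "g k"] by (auto simp: U_def)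
      qed
      then show "E (?g i) (?g j) \<longleftrightarrow> i < j"
        using \<open>i < Suc m\<close> \<open>j < Suc m\<close> g(2) irrefl[of v] by (auto split: nat.splits)
    qed
    ultimately show ?thesis
      using IH by (auto simp: d_def)
  next
    case False
    define k where "k = card I"
    have "k > 0"
      using False U by (auto simp: k_def I_def card_gt_0_iff)
    obtain u0 where "u0 \<in> I"
      using False by blast
    then have "d U u0 + 1 \<le> s"
      using vmax[of u0] dV[of u0] U by (simp add: I_def s_def)
    then have s1: "s \<ge> 1"
      using d_nonneg[of u0] by simp
    have "(\<Prod>u\<in>U. (if u \<in> I then 1 + 1 / s else 1) * (d U u + 1)) \<le> (\<Prod>u\<in>U. d V u + 1)"
    proof (intro prod_mono conjI)
      fix u assume u: "u \<in> U"
      show "0 \<le> (if u \<in> I then 1 + 1 / s else 1) * (d U u + 1)"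
        using s1 d_nonneg by simp
      show "(if u \<in> I then 1 + 1 / s else 1) * (d U u + 1) \<le> d V u + 1"
      proof (cases "u \<in> I")
        case True
        then have "d U u + 1 \<le> s"
          using vmax[of u] dV[OF u] u U by (simp add: s_def)
        then show ?thesis
          using True dV[OF u] s1 by (simp add: field_simps)
      qed (use dV[OF u] in simp)
    qed
    moreover have "(\<Prod>u\<in>U. if u \<in> I then 1 + 1 / s else 1) = (1 + 1 / s) ^ k"
      using U by (simp add: prod.If_cases k_def I_def Int_def conj_commute)
    ultimately have "(1 + 1 / s) ^ k * (\<Prod>u\<in>U. d U u + 1) \<le> (\<Prod>u\<in>U. d V u + 1)"
      by (simp add: prod.distrib)
    then have "(s + 1) * ((1 + 1 / s) ^ k * (\<Prod>u\<in>U. d U u + 1)) \<le> (\<Prod>u\<in>V. d V u + 1)"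
      unfolding prodV using s1 by (intro mult_left_mono) auto
    moreover have "fact (Suc m) < (s + 1) * ((1 + 1 / s) ^ k * (\<Prod>u\<in>U. d U u + 1))"
    proof -
      \<comment> \<open>As \<open>k = m - s\<close>, the right-hand side is \<open>(s + 1) * m / s = m + 1 + k / s\<close>.\<close>
      have "real (Suc m) < (s + 1) * (1 + real k * (1 / s))"
        using s1 sI \<open>k > 0\<close> by (simp add: k_def field_simps)
      also have "\<dots> \<le> (s + 1) * (1 + 1 / s) ^ k"
        using s1 by (intro mult_left_mono Bernoulli_inequality) (auto intro: order_trans[of _ 0])
      finally have "real (Suc m) * fact m < (s + 1) * (1 + 1 / s) ^ k * fact m"
        by simp
      also have "\<dots> \<le> (s + 1) * (1 + 1 / s) ^ k * (\<Prod>u\<in>U. d U u + 1)"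
        using IH s1 by (intro mult_left_mono) auto
      finally show ?thesis
        by (simp add: mult.assoc)
    qed
    ultimately show ?thesis
      by (simp add: d_def)
  qed
qed

section \<open>Arborescences and parent functions\<close>

lemma funpow_mem:
  assumes "\<And>u. u \<in> V \<Longrightarrow> f u \<in> V" "u \<in> V"
  shows "(f ^^ k) u \<in> V"
  using assms by (induction k) auto

lemma first_return_inj_on:
  assumes "(f ^^ m) x = x" and "\<And>k. 0 < k \<Longrightarrow> k < m \<Longrightarrow> (f ^^ k) x \<noteq> x"
  shows "inj_on (\<lambda>k. (f ^^ k) x) {..<m}"
proof (rule linorder_inj_onI)
  fix a b assume ab: "a < b" "a \<in> {..<m}" "b \<in> {..<m}"
  show "(f ^^ a) x \<noteq> (f ^^ b) x"
  proof
    assume "(f ^^ a) x = (f ^^ b) x"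
    then have "(f ^^ (m - b)) ((f ^^ a) x) = (f ^^ (m - b)) ((f ^^ b) x)"
      by simp
    then have "(f ^^ (m - b + a)) x = (f ^^ (m - b + b)) x"
      by (simp only: funpow_add comp_apply)
    then have "(f ^^ (m - b + a)) x = x"
      using ab assms(1) by simp
    then show False
      using assms(2)[of "m - b + a"] ab by fastforce
  qed
qed auto

lemma periodic_point_exists:
  assumes "finite V" and "\<And>u. u \<in> V \<Longrightarrow> f u \<in> V" and "u \<in> V"
  obtains j m where "m > 0" "(f ^^ m) ((f ^^ j) u) = (f ^^ j) u"
    "\<And>k. 0 < k \<Longrightarrow> k < m \<Longrightarrow> (f ^^ k) ((f ^^ j) u) \<noteq> (f ^^ j) u"
proof -
  have "range (\<lambda>k. (f ^^ k) u) \<subseteq> V"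
    using funpow_mem[of V f] assms by blast
  then have "\<not> inj (\<lambda>k. (f ^^ k) u)"
    using assms(1) by (metis finite_subset range_inj_infinite)
  then obtain a b where "a \<noteq> b" "(f ^^ a) u = (f ^^ b) u"
    by (auto simp: inj_def)
  then obtain j l where jl: "j < l" "(f ^^ j) u = (f ^^ l) u"
    by (metis linorder_neqE_nat)
  let ?P = "\<lambda>m. m > 0 \<and> (f ^^ m) ((f ^^ j) u) = (f ^^ j) u"
  have "(f ^^ (l - j)) ((f ^^ j) u) = (f ^^ (l - j + j)) u"
    by (simp only: funpow_add comp_apply)
  then have "?P (l - j)"
    using jl by simp
  then have "?P (LEAST m. ?P m)"
    by (rule LeastI)
  then show ?thesis
    using that[of "LEAST m. ?P m" j] not_less_Least[of _ ?P] by blast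
qed

text \<open>
  Conjugation with the relabelling; this connects a tournament on arbitrary vertices with the matrices,
  which are indexed by numbers.
\<close>
lemma card_parent_functions_bij:
  assumes g: "bij_betw g A V" and r: "r \<in> A" and N: "\<And>i. i \<in> A \<Longrightarrow> N i \<subseteq> A"
    and N': "\<And>i. i \<in> A \<Longrightarrow> N' (g i) = g ` N i"
  shows "card (parent_functions A N r) = card (parent_functions V N' (g r))"
proof -
  define h where "h = the_inv_into A g"
  have inj: "inj_on g A" and img: "g ` A = V"
    using g by (auto simp: bij_betw_def)
  have hg: "h (g i) = i" if "i \<in> A" for i
    using inj that by (simp add: h_def the_inv_into_f_f)
  have gh: "g (h u) = u" and hA: "h u \<in> A" if "u \<in> V" for u
    using that img hg by auto
  have gV: "g i \<in> V" if "i \<in> A" for i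
    using that img by blast
  have pow: "(f' ^^ k) (g i) = g ((f ^^ k) i) \<and> (f ^^ k) i \<in> A"
    if "\<And>i. i \<in> A \<Longrightarrow> f' (g i) = g (f i) \<and> f i \<in> A" "i \<in> A" for f f' k i
    using that by (induction k) auto
  have mem: "f i \<in> A" if "f \<in> parent_functions A N r" "i \<in> A" for f i
    using that N r by (force simp: parent_functions_def dest: PiE_mem split: if_splits)
  have NV: "N' u \<subseteq> V" if "u \<in> V" for u
    using N'[OF hA[OF that]] N[OF hA[OF that]] gh[OF that] img by auto
  have mem': "f u \<in> V" if "f \<in> parent_functions V N' (g r)" "u \<in> V" for f u
    using that NV gV[OF r] by (force simp: parent_functions_def dest: PiE_mem split: if_splits)
  have "bij_betw (\<lambda>f. \<lambda>u\<in>V. g (f (h u))) (parent_functions A N r) (parent_functions V N' (g r))"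
  proof (rule bij_betw_byWitness[where f' = "\<lambda>f. \<lambda>i\<in>A. h (f (g i))"])
    show "\<forall>f\<in>parent_functions A N r. (\<lambda>i\<in>A. h ((\<lambda>u\<in>V. g (f (h u))) (g i))) = f"
    proof
      fix f assume f: "f \<in> parent_functions A N r"
      then have "f \<in> extensional A"
        by (auto simp: parent_functions_def PiE_def)
      then show "(\<lambda>i\<in>A. h ((\<lambda>u\<in>V. g (f (h u))) (g i))) = f"
        using mem[OF f] hg gV by (auto simp: extensional_def fun_eq_iff)
    qed
    show "\<forall>f\<in>parent_functions V N' (g r). (\<lambda>u\<in>V. g ((\<lambda>i\<in>A. h (f (g i))) (h u))) = f"
    proof
      fix f assume f: "f \<in> parent_functions V N' (g r)"
      then have "f \<in> extensional V"
        by (auto simp: parent_functions_def PiE_def)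
      then show "(\<lambda>u\<in>V. g ((\<lambda>i\<in>A. h (f (g i))) (h u))) = f"
        using mem'[OF f] hA gh by (auto simp: extensional_def fun_eq_iff)
    qed
    show "(\<lambda>f. \<lambda>u\<in>V. g (f (h u))) ` parent_functions A N r \<subseteq> parent_functions V N' (g r)"
    proof clarify
      fix f assume f: "f \<in> parent_functions A N r"
      let ?f = "\<lambda>u\<in>V. g (f (h u))"
      have step: "?f (g i) = g (f i) \<and> f i \<in> A" if "i \<in> A" for i
        using that gV hg mem[OF f] by simp
      have "?f (g i) \<in> (if g i = g r then {g r} else N' (g i))" if "i \<in> A" for i
      proof -
        have "f i \<in> (if i = r then {r} else N i)"
          using f that by (auto simp: parent_functions_def dest: PiE_mem)
        then have "g (f i) \<in> (if g i = g r then {g r} else N' (g i))"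
          using N'[OF that] inj_on_eq_iff[OF inj that r] by (auto split: if_splits)
        then show ?thesis
          using step[OF that] by (simp only:)
      qed
      moreover have "\<exists>k. (?f ^^ k) (g i) = g r" if i: "i \<in> A" for i
      proof -
        have "\<exists>k. (f ^^ k) i = r"
          using f i by (simp add: parent_functions_def)
        then obtain k where k: "(f ^^ k) i = r" ..
        have "(?f ^^ k) (g i) = g ((f ^^ k) i) \<and> (f ^^ k) i \<in> A"
          by (rule pow, rule step, assumption, rule i)
        then show ?thesis
          using k by blast
      qed
      ultimately show "?f \<in> parent_functions V N' (g r)"
        unfolding parent_functions_def img[symmetric] by auto
    qed
    show "(\<lambda>f. \<lambda>i\<in>A. h (f (g i))) ` parent_functions V N' (g r) \<subseteq> parent_functions A N r"
    proof clarify
      fix f assume f: "f \<in> parent_functions V N' (g r)"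
      let ?f = "\<lambda>i\<in>A. h (f (g i))"
      have step: "f (g i) = g (?f i) \<and> ?f i \<in> A" if "i \<in> A" for i
        using that gV gh hA mem'[OF f] by simp
      have "?f i \<in> (if i = r then {r} else N i)" if "i \<in> A" for i
      proof -
        have "f (g i) \<in> (if g i = g r then {g r} else N' (g i))"
          using f gV[OF that] by (auto simp: parent_functions_def dest: PiE_mem)
        then have "g (?f i) \<in> g ` (if i = r then {r} else N i)"
          using step[OF that] N'[OF that] inj_on_eq_iff[OF inj that r] by (auto split: if_splits)
        moreover have "(if i = r then {r} else N i) \<subseteq> A"
          using r N[OF that] by simp
        ultimately show ?thesis
          using inj_on_image_mem_iff[OF inj] step[OF that] by blast
      qed
      moreover have "\<exists>k. (?f ^^ k) i = r" if i: "i \<in> A" for i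
      proof -
        have "\<exists>k. (f ^^ k) (g i) = g r"
          using f gV[OF i] by (simp add: parent_functions_def)
        then obtain k where k: "(f ^^ k) (g i) = g r" ..
        have "(f ^^ k) (g i) = g ((?f ^^ k) i) \<and> (?f ^^ k) i \<in> A"
          by (rule pow, rule step, assumption, rule i)
        then show ?thesis
          using k inj_on_eq_iff[OF inj _ r] by metis
      qed
      ultimately show "?f \<in> parent_functions A N r"
        unfolding parent_functions_def by auto
    qed
  qed
  then show ?thesis
    by (rule bij_betw_same_card)
qed

definition parent_graph :: "('a, 'b) pre_digraph \<Rightarrow> ('a \<Rightarrow> 'a) \<Rightarrow> ('a, 'b) pre_digraph" where
  "parent_graph G f = \<lparr>verts = verts G, arcs = {e \<in> arcs G. f (tail G e) = head G e},
     tail = tail G, head = head G\<rparr>"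

lemma parent_graph_simps [simp]:
  "verts (parent_graph G f) = verts G"
  "arcs (parent_graph G f) = {e \<in> arcs G. f (tail G e) = head G e}"
  "tail (parent_graph G f) = tail G" "head (parent_graph G f) = head G"
  by (simp_all add: parent_graph_def)

context digraph
begin

lemma arc_unique:
  assumes "e \<in> arcs G" "e' \<in> arcs G" "tail G e = tail G e'" "head G e = head G e'"
  shows "e = e'"
  using assms by (intro no_multi_arcs) (auto simp: arc_to_ends_def)

abbreviation "trees r \<equiv> parent_functions (verts G) (\<lambda>u. {w. u \<rightarrow> w}) r"

lemma trees_parent:
  assumes "f \<in> trees r" "u \<in> verts G"
  shows "u = r \<Longrightarrow> f u = r" and "u \<noteq> r \<Longrightarrow> u \<rightarrow> f u"
    and "f u \<in> verts G"
proof -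
  have *: "f u \<in> (if u = r then {r} else {w. u \<rightarrow> w})"
    using assms by (auto simp: parent_functions_def dest: PiE_mem)
  show "u = r \<Longrightarrow> f u = r" "u \<noteq> r \<Longrightarrow> u \<rightarrow> f u"
    using * by auto
  then show "f u \<in> verts G"
    using assms(2) adj_in_verts(2) by (cases "u = r") auto
qed

lemma inj_on_parent_graph:
  "inj_on (parent_graph G) (trees r)"
proof (rule inj_onI)
  fix f f' assume f: "f \<in> trees r" and f': "f' \<in> trees r" and eq: "parent_graph G f = parent_graph G f'"
  have arcs_eq: "{e \<in> arcs G. f (tail G e) = head G e} = {e \<in> arcs G. f' (tail G e) = head G e}"
    using arg_cong[OF eq, of arcs] by simp
  show "f = f'"
  proof (rule extensionalityI[of _ "verts G"])
    fix u assume u: "u \<in> verts G"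
    show "f u = f' u"
    proof (cases "u = r")
      case True
      then show ?thesis
        using trees_parent(1)[OF f u] trees_parent(1)[OF f' u] by simp
    next
      case False
      then obtain e where "e \<in> arcs G" "tail G e = u" "head G e = f u"
        using trees_parent(2)[OF f u] by blast
      moreover from this have "e \<in> {e \<in> arcs G. f' (tail G e) = head G e}"
        unfolding arcs_eq[symmetric] by simp
      ultimately show ?thesis
        by simp
    qed
  qed (use f f' in \<open>auto simp: parent_functions_def PiE_def\<close>)
qed

text \<open>
  Every arc of the parent graph is the only one at its tail, so a cycle with \<open>m\<close> arcs has \<open>m\<close> distinct
  tails, which are then all its vertices. The vertex set of the cycle is thus closed under \<open>f\<close> but avoids
  the root, which is impossible.
\<close>
lemma parent_graph_no_undirected_cycle:
  assumes f: "f \<in> trees r"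
  shows "\<not> undirected_cycle (parent_graph G f) vs es"
proof
  assume cyc: "undirected_cycle (parent_graph G f) vs es"
  then have len: "length es = length vs" "vs \<noteq> []" and dist: "distinct vs" "distinct es"
    and arcs: "\<And>e. e \<in> set es \<Longrightarrow> e \<in> arcs G \<and> f (tail G e) = head G e"
    and ends: "\<And>i. i < length vs \<Longrightarrow>
      {tail G (es ! i), head G (es ! i)} = {vs ! i, vs ! (Suc i mod length vs)}"
    by (auto simp: undirected_cycle_def)
  have ends_in: "tail G e \<in> set vs \<and> head G e \<in> set vs" if "e \<in> set es" for e
  proof -
    obtain i where i: "i < length vs" "e = es ! i"
      using \<open>e \<in> set es\<close> len by (metis in_set_conv_nth)
    then have "{vs ! i, vs ! (Suc i mod length vs)} \<subseteq> set vs"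
      using len by auto
    then show ?thesis
      using ends[OF i(1)] i(2) by blast
  qed
  have "inj_on (tail G) (set es)"
    using arcs by (intro inj_onI arc_unique) metis+
  then have "card (tail G ` set es) = card (set vs)"
    using len dist by (simp add: card_image distinct_card)
  moreover have "tail G ` set es \<subseteq> set vs"
    using ends_in by blast
  ultimately have tails: "tail G ` set es = set vs"
    by (intro card_subset_eq) auto
  have closed: "f u \<in> set vs \<and> u \<noteq> r \<and> u \<in> verts G" if "u \<in> set vs" for u
  proof -
    have "u \<in> tail G ` set es"
      using tails that by simp
    then obtain e where e: "e \<in> set es" "tail G e = u"
      by (auto simp: image_iff)
    then have "f u \<noteq> u"
      using arcs[OF e(1)] no_loops[of e] by auto
    moreover have "u \<in> verts G"
      using e arcs by auto
    moreover have "f u \<in> set vs"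
      using e arcs[OF e(1)] ends_in[OF e(1)] by simp
    ultimately show ?thesis
      using trees_parent(1)[OF f] by blast
  qed
  obtain u where u: "u \<in> set vs"
    using len by fastforce
  then have "(f ^^ k) u \<in> set vs" for k
    using closed by (intro funpow_mem) auto
  moreover have "\<exists>k. (f ^^ k) u = r"
    using f closed[OF u] by (simp add: parent_functions_def)
  ultimately show False
    using closed by blast
qed

lemma arborescence_parent_graph:
  assumes r: "r \<in> verts G" and f: "f \<in> trees r"
  shows "arborescence G r (parent_graph G f)"
proof -
  let ?H = "parent_graph G f"
  interpret H: wf_digraph ?H
    by unfold_locales auto
  have "spanning ?H G"
    by (auto simp: spanning_def subgraph_def compatible_def wf_digraph H.wf_digraph)
  moreover have reach: "u \<rightarrow>\<^sup>*\<^bsub>?H\<^esub> r" if "u \<in> verts G" for u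
  proof -
    have "\<exists>k. (f ^^ k) u = r"
      using f that by (simp add: parent_functions_def)
    then obtain k where "(f ^^ k) u = r" ..
    then show ?thesis
      using that
    proof (induction k arbitrary: u)
      case 0
      then show ?case using H.reachable_refl by simp
    next
      case (Suc k)
      show ?case
      proof (cases "u = r")
        case True
        then show ?thesis using Suc.prems H.reachable_refl by simp
      next
        case False
        then obtain e where "e \<in> arcs G" "tail G e = u" "head G e = f u"
          using trees_parent(2)[OF f Suc.prems(2)] by blast
        then have "u \<rightarrow>\<^bsub>?H\<^esub> f u"
          by (force simp: arcs_ends_conv)
        moreover have "f u \<rightarrow>\<^sup>*\<^bsub>?H\<^esub> r"
          using Suc trees_parent(3)[OF f] by (simp add: funpow_swap1)
        ultimately show ?thesis
          by (rule H.adj_reachable_trans)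
      qed
    qed
  qed
  have "connected ?H"
    unfolding connected_def
  proof (rule strongly_connectedI)
    fix u v assume "u \<in> verts (mk_symmetric ?H)" "v \<in> verts (mk_symmetric ?H)"
    then have "u \<rightarrow>\<^sup>*\<^bsub>mk_symmetric ?H\<^esub> r" "v \<rightarrow>\<^sup>*\<^bsub>mk_symmetric ?H\<^esub> r"
      using reach by (auto intro: H.reachable_mk_symmetricI)
    moreover have "wf_digraph (with_proj (mk_symmetric ?H))"
      using H.wellformed_mk_symmetric by (simp add: wf_digraph_wp_iff)
    ultimately show "u \<rightarrow>\<^sup>*\<^bsub>mk_symmetric ?H\<^esub> v"
      using symmetric_reachable[OF symmetric_mk_symmetric] wf_digraph.reachable_trans by metis
  qed (use r in auto)
  moreover have "out_arcs ?H r = {}"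
    using trees_parent(1)[OF f r] no_loops by (auto simp: out_arcs_def) metis
  moreover have "out_degree ?H u = 1" if "u \<in> verts G - {r}" for u
  proof -
    have "u \<rightarrow> f u"
      using trees_parent(2)[OF f] that by simp
    then obtain e where "e \<in> arcs G" "tail G e = u" "head G e = f u"
      by blast
    then have "out_arcs ?H u = {e}"
      by (auto simp: out_arcs_def intro: arc_unique)
    then show ?thesis
      by (simp add: out_degree_def)
  qed
  ultimately show ?thesis
    using r parent_graph_no_undirected_cycle[OF f]
    by (auto simp: arborescence_def undirected_tree_def out_degree_def)
qed

text \<open>
  Following parents from a vertex that never reaches the root eventually runs into a directed cycle,
  which in particular is an undirected one.
\<close>
lemma arborescence_imp_parent_graph:
  assumes H: "arborescence G r H"
  shows "\<exists>f\<in>trees r. H = parent_graph G f"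
proof -
  have r: "r \<in> verts G" and sub: "verts H = verts G" "arcs H \<subseteq> arcs G" "tail H = tail G" "head H = head G"
    and acyc: "\<And>vs es. \<not> undirected_cycle H vs es"
    and out_r: "card (out_arcs H r) = 0" and out_1: "\<And>u. u \<in> verts G - {r} \<Longrightarrow> card (out_arcs H u) = 1"
    using H by (auto simp: arborescence_def spanning_def subgraph_def compatible_def undirected_tree_def
        out_degree_def)
  have "finite (out_arcs H r)"
    using sub(2) by (auto simp: out_arcs_def intro: finite_subset[OF _ finite_arcs])
  then have no_out_r: "e \<notin> arcs H" if "tail G e = r" for e
    using out_r that sub by (auto simp: out_arcs_def)
  have "\<exists>e. out_arcs H u = {e}" if "u \<in> verts G - {r}" for u
    using out_1[OF that] by (simp add: card_1_singleton_iff)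
  then obtain a where a: "\<And>u. u \<in> verts G - {r} \<Longrightarrow> out_arcs H u = {a u}"
    by metis
  have a_arc: "a u \<in> arcs H" "tail G (a u) = u" if "u \<in> verts G - {r}" for u
    using a[OF that] sub by (auto simp: out_arcs_def set_eq_iff)
  define f where "f = (\<lambda>u\<in>verts G. if u = r then r else head G (a u))"
  have f_in: "f u \<in> verts G" if "u \<in> verts G" for u
    using that r a_arc[of u] sub(2) by (auto simp: f_def)
  have "\<exists>k. (f ^^ k) u = r" if u: "u \<in> verts G" for u
  proof (rule ccontr)
    assume never: "\<nexists>k. (f ^^ k) u = r"
    obtain j m where m: "m > 0" "(f ^^ m) ((f ^^ j) u) = (f ^^ j) u"
        "\<And>k. 0 < k \<Longrightarrow> k < m \<Longrightarrow> (f ^^ k) ((f ^^ j) u) \<noteq> (f ^^ j) u"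
      using periodic_point_exists[of "verts G" f u] f_in u finite_verts by metis
    define x where "x = (f ^^ j) u"
    have orbit: "(f ^^ k) x \<in> verts G - {r}" for k
    proof -
      have "(f ^^ k) x = (f ^^ (k + j)) u"
        by (simp only: x_def funpow_add comp_apply)
      then show ?thesis
        using never funpow_mem[of "verts G" f u] f_in u by auto
    qed
    define vs where "vs = map (\<lambda>k. (f ^^ k) x) [0..<m]"
    have "inj_on (\<lambda>k. (f ^^ k) x) {..<m}"
      using first_return_inj_on[of m f x] m unfolding x_def by blast
    then have "distinct vs"
      by (simp add: vs_def distinct_map lessThan_atLeast0)
    moreover have "set vs \<subseteq> verts G - {r}"
      using orbit by (auto simp: vs_def)
    moreover have "inj_on a (verts G - {r})"
      by (rule inj_onI) (metis a_arc(2))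
    ultimately have "distinct (map a vs)"
      by (simp add: distinct_map inj_on_subset)
    moreover have "{tail H (map a vs ! i), head H (map a vs ! i)} = {vs ! i, vs ! (Suc i mod length vs)}"
      if "i < length vs" for i
    proof -
      have i: "i < m"
        using that by (simp add: vs_def)
      have "vs ! (Suc i mod m) = (f ^^ Suc i) x"
        using i m(2) by (cases "Suc i = m") (auto simp: vs_def x_def simp del: funpow.simps)
      also have "\<dots> = head G (a (vs ! i))"
        using orbit[of i] i by (simp add: vs_def f_def)
      finally show ?thesis
        using i orbit[of i] a_arc(2)[OF orbit[of i]] sub by (simp add: vs_def)
    qed
    ultimately have "undirected_cycle H vs (map a vs)"
      using m(1) \<open>distinct vs\<close> \<open>set vs \<subseteq> _\<close> a_arc(1) by (auto simp: undirected_cycle_def vs_def)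
    then show False
      using acyc by blast
  qed
  moreover have "f \<in> PiE (verts G) (\<lambda>u. if u = r then {r} else {w. u \<rightarrow> w})"
  proof (rule PiE_I)
    fix u assume u: "u \<in> verts G"
    have "u \<rightarrow> head G (a u)" if "u \<noteq> r"
      using a_arc[of u] u that sub(2) by (force simp: arcs_ends_conv)
    then show "f u \<in> (if u = r then {r} else {w. u \<rightarrow> w})"
      using u by (simp add: f_def)
  qed (simp add: f_def)
  ultimately have "f \<in> trees r"
    by (simp add: parent_functions_def)
  moreover have "H = parent_graph G f"
  proof (rule pre_digraph.equality)
    have "e \<in> arcs H \<longleftrightarrow> e \<in> arcs G \<and> f (tail G e) = head G e" for e
    proof
      assume e: "e \<in> arcs H"
      then have "tail G e \<in> verts G - {r}"
        using no_out_r sub(2) by auto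
      moreover from this have "e = a (tail G e)"
        using a[of "tail G e"] e sub by (auto simp: out_arcs_def)
      ultimately show "e \<in> arcs G \<and> f (tail G e) = head G e"
        using e sub(2) by (auto simp: f_def)
    next
      assume e: "e \<in> arcs G \<and> f (tail G e) = head G e"
      then have u: "tail G e \<in> verts G - {r}"
        using no_loops[of e] r by (auto simp: f_def)
      then have "e = a (tail G e)"
        using e a_arc[OF u] sub(2) by (intro arc_unique) (auto simp: f_def)
      then show "e \<in> arcs H"
        using a_arc(1)[OF u] by simp
    qed
    then show "arcs H = arcs (parent_graph G f)"
      by auto
  qed (use sub in auto)
  ultimately show ?thesis
    by blast
qed

theorem arb_eq_card_parent_functions:
  assumes "r \<in> verts G"
  shows "arb G r = card (trees r)"
proof -
  have "{H. arborescence G r H} = parent_graph G ` trees r"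
    using arborescence_parent_graph[OF assms] arborescence_imp_parent_graph by blast
  then show ?thesis
    by (simp add: arb_def card_image inj_on_parent_graph)
qed

end

section \<open>Tournaments with the minimal number of arborescences\<close>

lemma (in tournament) allarb_eq_minor_sum:
  assumes g: "bij_betw g {0..<n} (verts G)"
  shows "real (allarb G) = (\<Sum>v<n. rooted_minor n (\<lambda>i j. g i \<rightarrow> g j) v)"
proof -
  let ?E = "\<lambda>i j. g i \<rightarrow> g j"
  have img: "g ` {0..<n} = verts G"
    using g by (simp add: bij_betw_def)
  have arb_g: "real (arb G (g v)) = rooted_minor n ?E v" if v: "v < n" for v
  proof -
    have "{w. g i \<rightarrow> w} = g ` outs n ?E i" for i
    proof -
      have "w \<in> g ` outs n ?E i" if "g i \<rightarrow> w" for w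
      proof -
        have "w \<in> g ` {0..<n}"
          using adj_in_verts(2)[OF that] img by simp
        then show ?thesis
          using that by (auto simp: outs_def)
      qed
      then show ?thesis
        by (auto simp: outs_def)
    qed
    then have "card (parent_functions {0..<n} (outs n ?E) v) = card (trees (g v))"
      using v by (intro card_parent_functions_bij[OF g]) (auto simp: outs_def)
    moreover have "g v \<in> verts G"
      using img v by auto
    ultimately show ?thesis
      using matrix_tree[OF v] arb_eq_card_parent_functions by simp
  qed
  have "allarb G = (\<Sum>v = 0..<n. arb G (g v))"
    unfolding allarb_def by (rule sum.reindex_bij_betw[OF g, symmetric])
  then show ?thesis
    using arb_g by (simp add: atLeast0LessThan)
qed

lemma rooted_minor_linear_order:
  assumes E: "\<And>i j. i < n \<Longrightarrow> j < n \<Longrightarrow> E i j \<longleftrightarrow> i < j" and v: "v < n"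
  shows "rooted_minor n E v = (\<Prod>i = 0..<n. if i = v then 1 else real (n - 1 - i))"
proof -
  define r where "r = (\<lambda>i j. if i = v then (if j = v then 1 else 0) else laplacian n E i j)"
  have outs: "card (outs n E i) = n - 1 - i" if "i < n" for i
  proof -
    have "outs n E i = {i<..<n}"
      using E that by (auto simp: outs_def)
    then show ?thesis by simp
  qed
  have "rdet n r = prod_list (diag_mat (mat n n (\<lambda>(i, j). r i j)))"
    by (rule det_upper_triangular[of _ n]) (use E in \<open>auto simp: r_def laplacian_def\<close>)
  also have "\<dots> = (\<Prod>i = 0..<n. r i i)"
    by (simp add: prod_list_diag_prod)
  also have "\<dots> = (\<Prod>i = 0..<n. if i = v then 1 else real (n - 1 - i))"
    by (rule prod.cong) (use E outs in \<open>auto simp: r_def laplacian_def\<close>)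
  finally show ?thesis
    by (simp add: rooted_minor_def r_def)
qed

lemma (in tournament) allarb_linear_order:
  assumes n: "n > 0" and g: "bij_betw g {0..<n} (verts G)"
    and lin: "\<And>i j. i < n \<Longrightarrow> j < n \<Longrightarrow> (g i \<rightarrow> g j) \<longleftrightarrow> i < j"
  shows "allarb G = fact (n - 1)"
proof -
  obtain m where m: "n = Suc m"
    using n by (cases n) auto
  let ?p = "\<lambda>v. \<Prod>i = 0..<n. if i = v then 1 else real (n - 1 - i)"
  have "real (allarb G) = (\<Sum>v<n. ?p v)"
    unfolding allarb_eq_minor_sum[OF g] by (intro sum.cong rooted_minor_linear_order lin) auto
  also have "\<dots> = ?p m"
  proof -
    have "?p v = 0" if "v \<noteq> m" for v
      using that by (intro prod_zero bexI[of _ m]) (auto simp: m)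
    then show ?thesis
      by (simp add: m)
  qed
  also have "?p m = (\<Prod>i = 0..<m. real (m - i))"
    by (simp add: m)
  also have "\<dots> = fact m"
    by (simp add: fact_prod_rev)
  finally have "real (allarb G) = real (fact m)"
    by simp
  then show ?thesis
    unfolding of_nat_eq_iff by (simp add: m)
qed

lemma arcs_ends_transitive_tournament:
  "arcs_ends (transitive_tournament n) = {(i, j). i \<in> {1..n} \<and> j \<in> {1..n} \<and> i < j}"
  by (auto simp: arcs_ends_conv transitive_tournament_def)

text \<open>
  A transitive tournament is an enumeration of the vertices along which all arcs point forward. In this
  form the equality case of \<open>score_product_ge_fact\<close> applies directly.
\<close>
lemma (in tournament) iso_transitive_tournament_iff:
  "digraph_iso G (transitive_tournament n) \<longleftrightarrow>
    (\<exists>g. bij_betw g {0..<n} (verts G) \<and> (\<forall>i<n. \<forall>j<n. (g i \<rightarrow> g j) \<longleftrightarrow> i < j))"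
    (is "?iso \<longleftrightarrow> ?enum")
proof
  assume ?iso
  then obtain f where f: "digraph_isomorphism f" and eq: "transitive_tournament n = app_iso f G"
    by (auto simp: digraph_iso_def)
  define h where "h = iso_verts f"
  have inj: "inj_on h (verts G)"
    using f by (simp add: h_def digraph_isomorphism_def)
  have "h ` verts G = {1..n}"
    using arg_cong[OF eq, of verts] by (simp add: h_def transitive_tournament_def)
  then have inv: "bij_betw (the_inv_into (verts G) h) {1..n} (verts G)"
    using inj by (metis bij_betw_the_inv_into bij_betw_def)
  define g where "g i = the_inv_into (verts G) h (Suc i)" for i
  have "bij_betw Suc {0..<n} {1..n}"
    by (auto simp: bij_betw_def image_Suc_atLeastLessThan)
  then have g: "bij_betw g {0..<n} (verts G)"
    using bij_betw_trans[OF _ inv] unfolding g_def comp_def by blast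
  have hg: "h (g i) = Suc i" if "i < n" for i
    unfolding g_def by (rule f_the_inv_into_f[OF inj]) (use \<open>h ` verts G = {1..n}\<close> that in auto)
  have "(g i \<rightarrow> g j) \<longleftrightarrow> i < j" if "i < n" "j < n" for i j
  proof -
    have gV: "g i \<in> verts G" "g j \<in> verts G"
      using g that by (auto simp: bij_betw_def)
    have "(g i \<rightarrow> g j) \<longleftrightarrow> (h (g i), h (g j)) \<in> arcs_ends (app_iso f G)"
    proof
      assume "(h (g i), h (g j)) \<in> arcs_ends (app_iso f G)"
      then obtain u w where uw: "u \<rightarrow> w" "h (g i) = h u" "h (g j) = h w"
        by (auto simp: arcs_ends_app_iso_eq[OF f] h_def)
      then have "g i = u" "g j = w"
        using inj_onD[OF inj] gV adj_in_verts[OF uw(1)] by auto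
      then show "g i \<rightarrow> g j"
        using uw by simp
    qed (force simp: arcs_ends_app_iso_eq[OF f] h_def)
    then show ?thesis
      using that by (simp add: hg arcs_ends_transitive_tournament flip: eq)
  qed
  then show ?enum
    using g by blast
next
  assume ?enum
  then obtain g where g: "bij_betw g {0..<n} (verts G)"
    and lin: "\<And>i j. i < n \<Longrightarrow> j < n \<Longrightarrow> (g i \<rightarrow> g j) \<longleftrightarrow> i < j"
    by blast
  define h where "h u = Suc (the_inv_into {0..<n} g u)" for u
  have inj: "inj_on g {0..<n}" and img: "verts G = g ` {0..<n}"
    using g by (auto simp: bij_betw_def)
  have hg: "h (g i) = Suc i" if "i < n" for i
    using the_inv_into_f_f[OF inj] that by (simp add: h_def)
  have inj_h: "inj_on h (verts G)"
    unfolding img by (auto intro!: inj_onI simp: hg)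
  define f where "f = \<lparr>iso_verts = h, iso_arcs = (\<lambda>e. (h (tail G e), h (head G e))),
    iso_head = snd, iso_tail = fst\<rparr>"
  have "inj_on (\<lambda>e. (h (tail G e), h (head G e))) (arcs G)"
    by (intro inj_onI arc_unique) (auto dest: inj_onD[OF inj_h])
  then have iso: "digraph_isomorphism f"
    using inj_h wf_digraph by (auto simp: digraph_isomorphism_def f_def)
  define R where "R = {(i, j). i < j \<and> j < n}"
  have "arcs_ends G = (\<lambda>(i, j). (g i, g j)) ` R"
  proof -
    have "(u, w) \<in> (\<lambda>(i, j). (g i, g j)) ` R" if uw: "u \<rightarrow> w" for u w
    proof -
      obtain i j where "i < n" "j < n" "u = g i" "w = g j"
        using adj_in_verts[OF uw] img by auto
      then show ?thesis
        using lin uw by (auto simp: R_def)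
    qed
    then show ?thesis
      using lin by (auto simp: R_def)
  qed
  then have "(\<lambda>(u, w). (h u, h w)) ` arcs_ends G = (\<lambda>(i, j). (Suc i, Suc j)) ` R"
    unfolding image_image by (simp only: image_image) (rule image_cong, auto simp: R_def hg)
  also have "\<dots> = {(i, j). i \<in> {1..n} \<and> j \<in> {1..n} \<and> i < j}"
  proof (intro subset_antisym subsetI)
    fix p assume "p \<in> {(i, j). i \<in> {1..n} \<and> j \<in> {1..n} \<and> i < j}"
    then show "p \<in> (\<lambda>(i, j). (Suc i, Suc j)) ` R"
      by (intro image_eqI[where x = "(fst p - 1, snd p - 1)"]) (auto simp: R_def)
  qed (auto simp: R_def)
  finally have "(\<lambda>e. (h (tail G e), h (head G e))) ` arcs G = {(i, j). i \<in> {1..n} \<and> j \<in> {1..n} \<and> i < j}"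
    by (simp add: arcs_ends_conv image_image)
  moreover have "h ` verts G = {1..n}"
    using hg by (simp add: img image_image image_Suc_atLeastLessThan atLeastLessThanSuc_atLeastAtMost)
  ultimately have "transitive_tournament n = app_iso f G"
    by (simp add: transitive_tournament_def app_iso_def f_def)
  then show ?iso
    using iso by (auto simp: digraph_iso_def)
qed

theorem theorem1p7:
  fixes T :: "('a, 'b) pre_digraph" and n :: nat
  assumes "tournament T" and "card (verts T) = n"
  shows "allarb T \<ge> allarb (transitive_tournament n) \<and>
    (allarb T = allarb (transitive_tournament n) \<longleftrightarrow> digraph_iso T (transitive_tournament n))"
proof -
  interpret tournament T
    by fact
  interpret TR: tournament "transitive_tournament n"
    by (rule tournament_transitive_tournament)
  obtain g where g: "bij_betw g {0..<n} (verts T)"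
    using ex_bij_betw_nat_finite[OF finite_verts] assms(2) by blast
  show ?thesis
  proof (cases "n = 0")
    case True
    \<comment> \<open>Without vertices there is no root, so both counts are 0 rather than \<open>(n - 1)! = 1\<close>.\<close>
    then have "bij_betw g {0..<n} (verts T) \<and> (\<forall>i<n. \<forall>j<n. (g i \<rightarrow>\<^bsub>T\<^esub> g j) \<longleftrightarrow> i < j)"
      using g by simp
    moreover have "verts T = {}" "verts (transitive_tournament n) = {}"
      using True g by (auto simp: bij_betw_def transitive_tournament_def)
    ultimately show ?thesis
      unfolding iso_transitive_tournament_iff by (auto simp: allarb_def)
  next
    case False
    then have n: "n > 0" by simp
    define E where "E i j \<longleftrightarrow> g i \<rightarrow>\<^bsub>T\<^esub> g j" for i j
    have gV: "g i \<in> verts T" if "i < n" for i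
      using g that by (auto simp: bij_betw_def)
    have irrefl: "\<not> E i i" for i
      using adj_not_same by (auto simp: E_def)
    have orient: "E i j \<longleftrightarrow> \<not> E j i" if "i < n" "j < n" "i \<noteq> j" for i j
    proof -
      have "g i \<noteq> g j"
        using g that by (auto simp: bij_betw_def dest: inj_onD)
      then show ?thesis
        unfolding E_def using orientation gV that by blast
    qed
    have "bij_betw Suc {0..<n} (verts (transitive_tournament n))"
      by (auto simp: bij_betw_def transitive_tournament_def image_Suc_atLeastLessThan)
    then have TR: "allarb (transitive_tournament n) = fact (n - 1)"
      by (rule TR.allarb_linear_order[OF n]) (auto simp: arcs_ends_transitive_tournament)
    have n_fact: "real n * fact (n - 1) = fact n"
      using n by (simp add: fact_reduce)
    let ?P = "\<Prod>u\<in>{0..<n}. real (card {w\<in>{0..<n}. E u w}) + 1"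
    have score: "?P \<ge> fact n \<and> (?P = fact n \<longrightarrow>
        (\<exists>g'. bij_betw g' {0..<n} {0..<n} \<and> (\<forall>i<n. \<forall>j<n. E (g' i) (g' j) \<longleftrightarrow> i < j)))"
      by (rule score_product_ge_fact[OF _ _ irrefl], simp, simp, rule orient) auto
    have bound: "real n * real (allarb T) \<ge> ?P"
      using tournament_minor_sum_ge[OF n irrefl orient] allarb_eq_minor_sum[OF g]
      by (simp add: E_def[abs_def] outs_def)
    then have "real n * fact (n - 1) \<le> real n * real (allarb T)"
      unfolding n_fact using score by linarith
    then have "real (fact (n - 1)) \<le> real (allarb T)"
      using n by simp
    then have ge: "allarb T \<ge> fact (n - 1)"
      by linarith
    have "digraph_iso T (transitive_tournament n)" if "allarb T = fact (n - 1)"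
    proof -
      have "?P = fact n"
        using bound score n_fact that by simp
      then obtain g' where g': "bij_betw g' {0..<n} {0..<n}" "\<forall>i<n. \<forall>j<n. E (g' i) (g' j) \<longleftrightarrow> i < j"
        using score by blast
      then have "bij_betw (g \<circ> g') {0..<n} (verts T) \<and>
          (\<forall>i<n. \<forall>j<n. ((g \<circ> g') i \<rightarrow>\<^bsub>T\<^esub> (g \<circ> g') j) \<longleftrightarrow> i < j)"
        using bij_betw_trans[OF g'(1) g] by (simp add: E_def)
      then show ?thesis
        unfolding iso_transitive_tournament_iff by blast
    qed
    moreover have "allarb T = fact (n - 1)" if "digraph_iso T (transitive_tournament n)"
      using that allarb_linear_order[OF n] unfolding iso_transitive_tournament_iff by blast
    ultimately show ?thesis
      using ge TR by auto
  qed
qed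

end
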